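(* For each dimension $d \ge 1$, let $c_d$ denote the smallest constant $c>0$ such that for all $\alpha>0$ and all $f \in L^1(\mathbb{R}^d)$, \[ \alpha \,\bigl|\{x\in\mathbb{R}^d : M_d f(x) \ge \alpha\}\bigr| \le c\, \|f\|_1, \] where $|\cdot|$ is Lebesgue measure and \[ M_d f(x) := \sup_{r>0} \frac{1}{|Q(x,r)|}\int_{Q(x,r)} |f(y)|\,dy, \] with $Q(x,r) = \{y\in\mathbb{R}^d : \max_{1\le i\le d}|y_i - x_i| \le r\}$ the closed cube centered at $x$ with sides parallel to the coordinate axes and sidelength $2r$. Then for every $T>0$ there exists $D = D(T)$ such that $c_d \ge T$ for every $d \ge D$. In particular, $c_d \to \infty$ as $d \to \infty$.
   Context: $M_d$ is the centered Hardy–Littlewood maximal operator associated to cubes (closed $\ell_\infty$ balls) and Lebesgue measure on $\mathbb{R}^d$; $c_d$ is the best constant in its weak type $(1,1)$ inequality. *)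

theory Defs
  imports "HOL-Analysis.Analysis"
begin

text \<open>Lebesgue (Borel) measure on R^d, points represented as functions
  nat => real restricted to the index set {..<d} (extensional).\<close>
definition lebd :: "nat \<Rightarrow> (nat \<Rightarrow> real) measure" where
  "lebd d = PiM {..<d} (\<lambda>_. lborel)"

definition cube :: "nat \<Rightarrow> (nat \<Rightarrow> real) \<Rightarrow> real \<Rightarrow> (nat \<Rightarrow> real) set" where
  "cube d x r = {y \<in> space (lebd d). \<forall>i<d. \<bar>y i - x i\<bar> \<le> r}"

definition maxfun :: "nat \<Rightarrow> ((nat \<Rightarrow> real) \<Rightarrow> real) \<Rightarrow> (nat \<Rightarrow> real) \<Rightarrow> ennreal" where
  "maxfun d f x = (SUP r\<in>{0<..}.
      (\<integral>\<^sup>+ y\<in>cube d x r. ennreal \<bar>f y\<bar> \<partial>lebd d) / emeasure (lebd d) (cube d x r))"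

definition weak11 :: "nat \<Rightarrow> real \<Rightarrow> bool" where
  "weak11 d c \<longleftrightarrow> (\<forall>f \<alpha>. integrable (lebd d) f \<longrightarrow> \<alpha> > 0 \<longrightarrow>
      ennreal \<alpha> * emeasure (lebd d) {x \<in> space (lebd d). maxfun d f x \<ge> ennreal \<alpha>}
        \<le> ennreal c * ennreal (\<integral>x. \<bar>f x\<bar> \<partial>lebd d))"

text \<open>Best constant c_d (infimum, in the extended reals; +infinity if no constant works).\<close>
definition best_const :: "nat \<Rightarrow> ereal" where
  "best_const d = Inf {ereal c | c. c > 0 \<and> weak11 d c}"

end

theory Submission
  imports Defs
begin

text \<open>
  The extremal functions approximate sums of point masses on a product of shifted lattices
  c_i + 2^(-k_i) \<int>, the coordinates being grouped into blocks of equal mesh. If 2 r = (M + 1/2) a and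
  a coordinate has mesh a, then the interval of radius r about x_i contains M or M + 1 lattice
  points, each on half of the x_i. For a block of b = 4 M^2 coordinates the normalised product of these
  counts behaves like a log-normal variable, so it exceeds T with a probability p > 0 that does not
  depend on M (a fourth moment bound suffices). Take meshes a_j = 2^(-j), radii 2 r_j = (M_j + 1/2) a_j and
  M_j growing fast. At the scale r_j the finer blocks contribute a factor at least 1, because
  2 r_j is a multiple of their mesh, and the coarser blocks at least 1/2, because r_j is huge. Hence the
  blocks provide independent chances p, and all but a small fraction of the x have a cube of density T.
\<close>

section \<open>Large deviations of sizes of random subsets\<close>

text \<open>Subsets of \<open>{..<n}\<close> stand for 0/1 strings of length \<open>n\<close>; this
  is concatenation of strings, with \<open>R\<close> moved behind the first \<open>n\<close>
  places.\<close>

definition join :: "nat \<Rightarrow> nat set \<Rightarrow> nat set \<Rightarrow> nat set" where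
  "join n S R = S \<union> (+) n ` R"

lemma join_left: "S \<subseteq> {..<n} \<Longrightarrow> join n S R \<inter> {..<n} = S"
  by (auto simp: join_def)

lemma join_right: "S \<subseteq> {..<n} \<Longrightarrow> {i. n + i \<in> join n S R} = R"
  by (auto simp: join_def)

lemma join_restrict: "join n (S \<inter> {..<n}) {i. n + i \<in> S} = S"
proof -
  have "i \<in> join n (S \<inter> {..<n}) {i. n + i \<in> S}" if "i \<in> S" for i
    using that by (cases "i < n") (auto simp: join_def image_iff intro!: exI[of _ "i - n"])
  then show ?thesis by (auto simp: join_def)
qed

lemma bij_betw_join:
  "bij_betw (\<lambda>(S, R). join n S R) (Pow {..<n} \<times> Pow {..<m}) (Pow {..<n + m})"
  by (rule bij_betw_byWitness[where f' = "\<lambda>S. (S \<inter> {..<n}, {i. n + i \<in> S})"])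
     (auto simp: join_left join_right join_restrict, auto simp: join_def)

lemma card_join:
  assumes "S \<subseteq> {..<n}" "R \<subseteq> {..<m}"
  shows "card (join n S R) = card S + card R"
proof -
  have "card (join n S R) = card S + card ((+) n ` R)"
    unfolding join_def using assms finite_subset
    by (intro card_Un_disjoint) (auto dest: finite_subset)
  then show ?thesis by (simp add: card_image)
qed

text \<open>Independence in counting form: joining one set from each tail is injective and adds the
  cardinalities.\<close>

lemma card_tail_add:
  fixes s t :: real and n m :: nat
  shows "card {S \<in> Pow {..<n}. s \<le> card S} * card {R \<in> Pow {..<m}. t \<le> card R}
           \<le> card {S \<in> Pow {..<n + m}. s + t \<le> card S}"
proof -
  let ?A = "{S \<in> Pow {..<n}. s \<le> card S} \<times> {R \<in> Pow {..<m}. t \<le> card R}"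
  have "card ?A = card ((\<lambda>(S, R). join n S R) ` ?A)"
    using bij_betw_join[of n m]
    by (intro card_image[symmetric] inj_on_subset[OF bij_betw_imp_inj_on]) auto
  also have "\<dots> \<le> card {S \<in> Pow {..<n + m}. s + t \<le> card S}"
  proof (rule card_mono)
    show "(\<lambda>(S, R). join n S R) ` ?A \<subseteq> {S \<in> Pow {..<n + m}. s + t \<le> card S}"
      by (auto simp: card_join simp del: of_nat_add) (auto simp: join_def)
  qed auto
  finally show ?thesis by (simp add: card_cartesian_product)
qed

lemma card_tail_power:
  fixes t :: real
  shows "card {S \<in> Pow {..<q}. t \<le> card S} ^ L \<le> card {S \<in> Pow {..<L * q}. L * t \<le> card S}"
proof (induction L)
  case 0
  have "{S \<in> Pow {..<0 * q}. real 0 * t \<le> card S} = {{}}" by auto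
  then show ?case by simp
next
  case (Suc L)
  have "card {S \<in> Pow {..<q}. t \<le> card S} ^ Suc L
      \<le> card {S \<in> Pow {..<q}. t \<le> card S} * card {S \<in> Pow {..<L * q}. L * t \<le> card S}"
    using Suc.IH by simp
  also have "\<dots> \<le> card {S \<in> Pow {..<q + L * q}. t + L * t \<le> card S}"
    by (rule card_tail_add)
  finally show ?case by (simp add: algebra_simps)
qed

section \<open>Moments and tails of a sum of random signs\<close>

lemma sum_Pow_Suc:
  fixes \<phi> :: "real \<Rightarrow> real"
  shows "(\<Sum>S\<in>Pow {..<Suc n}. \<phi> (2 * real (card S) - Suc n))
       = (\<Sum>S\<in>Pow {..<n}. \<phi> (2 * real (card S) - n - 1) + \<phi> (2 * real (card S) - n + 1))"
proof -
  \<comment> \<open>For a uniformly random \<open>S\<close>, the number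
    \<open>2 * card S - n\<close> is a sum of \<open>n\<close> random signs; membership of the new
    element decides the last sign.\<close>
  have "Pow {..<Suc n} = Pow {..<n} \<union> insert n ` Pow {..<n}"
    by (simp add: lessThan_Suc Pow_insert)
  moreover have "inj_on (insert n) (Pow {..<n})"
    by (auto simp: inj_on_def insert_ident)
  moreover have "card (insert n S) = Suc (card S)" if "S \<in> Pow {..<n}" for S
    using that by (subst card_insert_disjoint) (auto dest: finite_subset)
  moreover have "Pow {..<n} \<inter> insert n ` Pow {..<n} = {}" by force
  ultimately have "(\<Sum>S\<in>Pow {..<Suc n}. \<phi> (2 * real (card S) - Suc n))
      = (\<Sum>S\<in>Pow {..<n}. \<phi> (2 * real (card S) - Suc n))
      + (\<Sum>S\<in>Pow {..<n}. \<phi> (2 * real (Suc (card S)) - Suc n))"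
    by (simp add: sum.union_disjoint sum.reindex del: Pow_iff)
  then show ?thesis by (simp add: sum.distrib[symmetric] algebra_simps)
qed

lemma sum_Pow_second_moment:
  "(\<Sum>S\<in>Pow {..<n}. (2 * real (card S) - n) ^ 2) = n * 2 ^ n"
proof (induction n)
  case (Suc n)
  have "(x - 1) ^ 2 + (x + 1) ^ 2 = 2 * x ^ 2 + 2" for x :: real
    by (simp add: power2_eq_square algebra_simps)
  then have "(\<Sum>S\<in>Pow {..<Suc n}. (2 * real (card S) - Suc n) ^ 2)
      = (\<Sum>S\<in>Pow {..<n}. 2 * (2 * real (card S) - n) ^ 2 + 2)"
    by (subst sum_Pow_Suc[where \<phi> = "\<lambda>x. x ^ 2"]) simp
  also have "\<dots> = 2 * (n * 2 ^ n) + 2 * 2 ^ n"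
    unfolding sum.distrib sum_distrib_left[symmetric] Suc.IH by (simp add: card_Pow)
  finally show ?case by (simp add: algebra_simps)
qed simp

lemma sum_Pow_fourth_moment:
  "(\<Sum>S\<in>Pow {..<n}. (2 * real (card S) - n) ^ 4) = (3 * n ^ 2 - 2 * real n) * 2 ^ n"
proof (induction n)
  case (Suc n)
  have "(x - 1) ^ 4 + (x + 1) ^ 4 = 2 * x ^ 4 + 12 * x ^ 2 + 2" for x :: real
    by (simp add: power4_eq_xxxx power2_eq_square algebra_simps)
  then have "(\<Sum>S\<in>Pow {..<Suc n}. (2 * real (card S) - Suc n) ^ 4)
      = (\<Sum>S\<in>Pow {..<n}. 2 * (2 * real (card S) - n) ^ 4 + 12 * (2 * real (card S) - n) ^ 2 + 2)"
    by (subst sum_Pow_Suc[where \<phi> = "\<lambda>x. x ^ 4"]) simp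
  also have "\<dots> = 2 * ((3 * n ^ 2 - 2 * real n) * 2 ^ n) + 12 * (n * 2 ^ n) + 2 * 2 ^ n"
    unfolding sum.distrib sum_distrib_left[symmetric] Suc.IH sum_Pow_second_moment
    by (simp add: card_Pow)
  finally show ?case by (simp add: power2_eq_square algebra_simps)
qed simp

text \<open>The set size is a square so that the standard deviation of \<open>card S\<close> is
  \<open>s / 2\<close>; an excess of half of that has probability bounded below uniformly in
  \<open>s\<close>. Paley--Zygmund bounds the two tails together by 3/16, and symmetry halves
  this.\<close>

lemma card_tail_ge:
  assumes s: "s > 0"
  shows "3 / 32 * 2 ^ (s ^ 2) \<le> card {S \<in> Pow {..<s ^ 2}. real (s ^ 2) / 2 + s / 4 \<le> card S}"
proof -
  let ?n = "s ^ 2"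
  let ?P = "Pow {..<?n}"
  define X where "X S = 2 * real (card S) - real ?n" for S :: "nat set"
  let ?U = "{S \<in> ?P. s / 2 \<le> X S}" and ?L = "{S \<in> ?P. X S \<le> - (s / 2)}"
  \<comment> \<open>Complementation reverses all signs, so both tails have the same size.\<close>
  have compl: "X ({..<?n} - S) = - X S" if "S \<in> ?P" for S
  proof -
    have "card ({..<?n} - S) = ?n - card S" "card S \<le> ?n"
      using that card_mono[of "{..<?n}" S] by (auto simp: card_Diff_subset finite_subset)
    then show ?thesis by (simp add: X_def of_nat_diff)
  qed
  have "bij_betw (\<lambda>S. {..<?n} - S) ?U ?L"
    by (rule bij_betw_byWitness[where f' = "\<lambda>S. {..<?n} - S"]) (auto simp: compl)
  then have cards: "card ?L = card ?U" by (simp add: bij_betw_same_card)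
  \<comment> \<open>Paley--Zygmund with z = X^2/n, E z = 1 and E z^2 \<le> 3: this quadratic in z is at most
    the indicator of z \<ge> 1/4.\<close>
  have le: "1/2 * (X S ^ 2 / real ?n - 1/4) - X S ^ 4 / real ?n ^ 2 / 16
      \<le> (if S \<in> ?U then 1 else 0) + (if S \<in> ?L then 1 else 0)" if "S \<in> ?P" for S
  proof -
    define z where "z = (X S / s) ^ 2"
    have z: "X S ^ 2 / real ?n = z" "X S ^ 4 / real ?n ^ 2 = z ^ 2"
      by (simp_all add: z_def power_divide flip: power_mult)
    show ?thesis
    proof (cases "S \<in> ?U \<or> S \<in> ?L")
      case True
      have "1/2 * (z - 1/4) - z ^ 2 / 16 = 7/8 - (z / 4 - 1) ^ 2"
        by (simp add: power2_eq_square algebra_simps)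
      also have "\<dots> \<le> 1" using zero_le_power2[of "z / 4 - 1"] by linarith
      finally have "1/2 * (z - 1/4) - z ^ 2 / 16 \<le> 1" .
      moreover have "(1::real) \<le> (if S \<in> ?U then 1 else 0) + (if S \<in> ?L then 1 else 0)"
        using True by auto
      ultimately show ?thesis unfolding z by linarith
    next
      case False
      then have "\<bar>X S / s\<bar> \<le> 1/2" using that s by (auto simp: field_simps abs_le_iff)
      then have "z \<le> (1/2) ^ 2" unfolding z_def by (metis abs_le_square_iff abs_of_nonneg
          divide_nonneg_pos zero_le_one zero_less_numeral)
      then have "z \<le> 1/4" by (simp add: power2_eq_square)
      then have "1/2 * (z - 1/4) - z ^ 2 / 16 \<le> 0"
        using zero_le_power2[of z] by (simp add: field_simps add_increasing2 del: zero_le_power2)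
      moreover have "(0::real) \<le> (if S \<in> ?U then 1 else 0) + (if S \<in> ?L then 1 else 0)"
        by simp
      ultimately show ?thesis unfolding z by linarith
    qed
  qed
  \<comment> \<open>The expectation of the quadratic, with \<open>P\<close> the number of subsets:
    1/2 (1 - 1/4) - 3/16 = 3/16, and the lower-order part of the fourth moment only helps.\<close>
  have arith: "3 / 16 * P \<le> 1/2 * (N * P / N - 1/4 * P) - ((3 * N ^ 2 - 2 * N) * P) / N ^ 2 / 16"
    if "N > 0" "P \<ge> 0" for N P :: real
  proof -
    have "1/2 * (N * P / N - 1/4 * P) - ((3 * N ^ 2 - 2 * N) * P) / N ^ 2 / 16 = 3 / 16 * P + P / N / 8"
      using that by (simp add: field_simps power2_eq_square)
    then show ?thesis using that by simp
  qed
  have "3 / 16 * 2 ^ ?n \<le> 1/2 * (real ?n * 2 ^ ?n / real ?n - 1/4 * 2 ^ ?n)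
      - ((3 * real ?n ^ 2 - 2 * real ?n) * 2 ^ ?n) / real ?n ^ 2 / 16"
    using s by (intro arith) auto
  also have "\<dots> = (\<Sum>S\<in>?P. 1/2 * (X S ^ 2 / real ?n - 1/4) - X S ^ 4 / real ?n ^ 2 / 16)"
    unfolding sum_subtractf sum_distrib_left[symmetric] sum_divide_distrib[symmetric]
      X_def sum_Pow_fourth_moment sum_Pow_second_moment by (simp add: card_Pow)
  also have "\<dots> \<le> (\<Sum>S\<in>?P. (if S \<in> ?U then 1 else 0) + (if S \<in> ?L then 1 else 0))"
    by (rule sum_mono) (rule le)
  also have "\<dots> = 2 * card ?U"
    using cards by (simp add: sum.distrib sum.If_cases Int_def)
  finally have "3 / 32 * 2 ^ ?n \<le> real (card ?U)" by simp
  also have "?U = {S \<in> ?P. real ?n / 2 + s / 4 \<le> card S}"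
    by (auto simp: X_def field_simps)
  finally show ?thesis .
qed

text \<open>The point is the order of quantifiers: \<open>p\<close> depends on \<open>T\<close>
  alone, while \<open>M\<close> can be taken as large as desired. With u = 1/M, a surplus of
  \<open>A * M\<close> over half of the coordinates gains (1 + u)^(AM) \<ge> 2^A, while the balanced
  part of the product loses at most a factor 2 against (1 + u/2)^b.\<close>

lemma block_exists:
  fixes T :: real
  assumes "T > 0"
  obtains p :: real where "p > 0" "p \<le> 1"
    and "\<And>M0. \<exists>M b B. M \<ge> M0 \<and> M > 0 \<and> B \<subseteq> Pow {..<b} \<and> p * 2 ^ b \<le> card B \<and>
           (\<forall>S\<in>B. T * (real M + 1/2) ^ b \<le> (real M + 1) ^ card S * real M ^ (b - card S))"
proof -
  \<comment> \<open>The factor 2 pays for the loss of the balanced part. The successor below makes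
    \<open>A\<close> positive, hence \<open>M\<close> at least \<open>s\<close>.\<close>
  obtain A' where A': "2 * T < 2 ^ A'" using real_arch_pow[of 2 "2 * T"] by auto
  define A where "A = Suc A'"
  have A: "A > 0" "2 * T \<le> 2 ^ A" using A' \<open>T > 0\<close> by (auto simp: A_def)
  define p :: real where "p = (3 / 32) ^ (4 * A ^ 2)"
  have "\<exists>M b B. M \<ge> M0 \<and> M > 0 \<and> B \<subseteq> Pow {..<b} \<and> p * 2 ^ b \<le> card B \<and>
           (\<forall>S\<in>B. T * (real M + 1/2) ^ b \<le> (real M + 1) ^ card S * real M ^ (b - card S))" for M0
  proof -
    \<comment> \<open>The block splits into 4 A^2 sub-blocks of size s^2; each has an excess of s / 4 with probability
      at least 3/32, which adds up to A M.\<close>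
    define s where "s = Suc M0"
    define M where "M = A * s"
    define b where "b = 4 * M ^ 2"
    have bL: "b = 4 * A ^ 2 * s ^ 2" by (simp add: b_def M_def power_mult_distrib)
    define B where "B = {S \<in> Pow {..<b}. real (2 * M ^ 2 + A * M) \<le> card S}"
    have "1 * s \<le> A * s" using A by (intro mult_right_mono) auto
    then have M: "M \<ge> M0" "M > 0" by (auto simp: M_def s_def)
    have "p * 2 ^ b = (3 / 32 * 2 ^ (s ^ 2)) ^ (4 * A ^ 2)"
      unfolding p_def bL power_mult_distrib power_mult[symmetric] by (simp add: mult_ac)
    also have "\<dots> \<le> real (card {S \<in> Pow {..<s ^ 2}. real (s ^ 2) / 2 + s / 4 \<le> card S}) ^ (4 * A ^ 2)"
      by (intro power_mono card_tail_ge) (auto simp: s_def)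
    also have "\<dots> \<le> card {S \<in> Pow {..<4 * A ^ 2 * s ^ 2}.
        real (4 * A ^ 2) * (real (s ^ 2) / 2 + s / 4) \<le> card S}"
      using of_nat_mono[OF card_tail_power[of "s ^ 2" "real (s ^ 2) / 2 + s / 4" "4 * A ^ 2"], where 'a = real]
      by (simp only: of_nat_power)
    also have "real (4 * A ^ 2) * (real (s ^ 2) / 2 + s / 4) = real (2 * M ^ 2 + A * M)"
      by (simp add: M_def power2_eq_square algebra_simps)
    finally have cardB: "p * 2 ^ b \<le> card B" by (simp add: B_def bL)
    have "T * (real M + 1/2) ^ b \<le> (real M + 1) ^ card S * real M ^ (b - card S)" if S: "S \<in> B" for S
    proof -
      have cS: "2 * M ^ 2 + A * M \<le> card S" using S unfolding B_def of_nat_le_iff by simp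
      have cb: "card S \<le> b" using S card_mono[of "{..<b}" S] by (auto simp: B_def)
      define u where "u = 1 / real M"
      have u: "u > 0" using M by (simp add: u_def)
      \<comment> \<open>Since u = 1/M, the 2 M^2 pairs of coordinates with second-order loss (u/2)^2
        each lose 1/2 in total; Bernoulli turns the sum into a product.\<close>
      have "1/2 = 1 + real (2 * M ^ 2) * (- ((u / 2) ^ 2))"
        using M by (simp add: u_def power2_eq_square)
      also have "\<dots> \<le> (1 + (- ((u / 2) ^ 2))) ^ (2 * M ^ 2)"
      proof (rule Bernoulli_inequality)
        have "u \<le> 1" using M by (simp add: u_def)
        then have "(u/2) ^ 2 \<le> 1" using u by (intro power_le_one) auto
        then show "- 1 \<le> - ((u / 2) ^ 2)" by simp
      qed
      finally have h: "1/2 \<le> (1 - (u / 2) ^ 2) ^ (2 * M ^ 2)" by simp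
      \<comment> \<open>Compares one balanced pair, with counts M + 1 and M, to two coordinates of
        average count M + 1/2, all divided by M.\<close>
      have "(1 - (u / 2) ^ 2) * (1 + u / 2) ^ 2 \<le> 1 + u"
      proof -
        have "(1 - (u / 2) ^ 2) * (1 + u / 2) ^ 2 = 1 + u - u ^ 3 / 4 - u ^ 4 / 16"
          by (simp add: power2_eq_square power3_eq_cube power4_eq_xxxx algebra_simps)
        moreover have "u ^ 3 \<ge> 0" "u ^ 4 \<ge> 0" using u by auto
        ultimately show ?thesis by linarith
      qed
      moreover have "0 \<le> (1 - (u / 2) ^ 2) * (1 + u / 2) ^ 2"
        using u M by (intro mult_nonneg_nonneg) (auto simp: u_def power_divide field_simps intro: mult_ge1_I)
      ultimately have "((1 - (u / 2) ^ 2) * (1 + u / 2) ^ 2) ^ (2 * M ^ 2) \<le> (1 + u) ^ (2 * M ^ 2)"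
        by (intro power_mono)
      then have h2: "(1 - (u / 2) ^ 2) ^ (2 * M ^ 2) * (1 + u / 2) ^ b \<le> (1 + u) ^ (2 * M ^ 2)"
        by (simp add: power_mult_distrib b_def flip: power_mult)
      have "2 = 1 + real M * u" using M by (simp add: u_def)
      also have "\<dots> \<le> (1 + u) ^ M" using u by (intro Bernoulli_inequality) simp
      finally have "2 ^ A \<le> ((1 + u) ^ M) ^ A" by (intro power_mono) auto
      then have h3: "2 * T \<le> (1 + u) ^ (A * M)" using A by (simp add: mult.commute flip: power_mult)
      have "T * (1 + u / 2) ^ b = 2 * T * (1/2 * (1 + u / 2) ^ b)" by simp
      also have "\<dots> \<le> 2 * T * ((1 - (u / 2) ^ 2) ^ (2 * M ^ 2) * (1 + u / 2) ^ b)"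
        using h u \<open>T > 0\<close> by (intro mult_left_mono mult_right_mono) auto
      also have "\<dots> \<le> (1 + u) ^ (A * M) * (1 + u) ^ (2 * M ^ 2)"
        using h3 h2 u \<open>T > 0\<close> h by (intro mult_mono mult_nonneg_nonneg order_trans[OF _ h]) auto
      also have "\<dots> = (1 + u) ^ (2 * M ^ 2 + A * M)" by (simp add: power_add)
      also have "\<dots> \<le> (1 + u) ^ card S" using cS u by (intro power_increasing) auto
      finally have le: "T * (1 + u / 2) ^ b \<le> (1 + u) ^ card S" .
      have "real M + 1/2 = real M * (1 + u / 2)" "real M + 1 = real M * (1 + u)"
        using M by (simp_all add: u_def algebra_simps)
      then have e1: "T * (real M + 1/2) ^ b = real M ^ b * (T * (1 + u / 2) ^ b)"
        and e2: "(real M + 1) ^ card S * real M ^ (b - card S) = real M ^ card S * real M ^ (b - card S) * (1 + u) ^ card S"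
        by (simp_all add: power_mult_distrib)
      have e3: "real M ^ card S * real M ^ (b - card S) = real M ^ b"
        using cb by (simp flip: power_add)
      show ?thesis unfolding e1 e2 e3 by (rule mult_left_mono[OF le]) simp
    qed
    with M cardB show ?thesis by (intro exI[of _ M] exI[of _ b] exI[of _ B]) (auto simp: B_def)
  qed
  moreover have "p > 0" "p \<le> 1" by (auto simp: p_def intro: power_le_one)
  ultimately show ?thesis by (intro that)
qed

section \<open>Lattice counts and good patterns\<close>

definition lattice_count :: "nat \<Rightarrow> real \<Rightarrow> real \<Rightarrow> real \<Rightarrow> nat" where
  "lattice_count k c x r = card {n::int. \<bar>c + n / 2 ^ k - x\<bar> \<le> r}"

lemma lattice_points_eq:
  "{n::int. \<bar>c + n / 2 ^ k - x\<bar> \<le> r} = {\<lceil>(x - r - c) * 2 ^ k\<rceil>..\<lfloor>(x + r - c) * 2 ^ k\<rfloor>}"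
proof -
  have eq: "\<bar>c + q - x\<bar> \<le> r \<longleftrightarrow> x - r - c \<le> q \<and> q \<le> x + r - c" for q :: real
    by (simp only: abs_le_iff) linarith
  have eq2: "\<bar>c + n / 2 ^ k - x\<bar> \<le> r \<longleftrightarrow>
      (x - r - c) * 2 ^ k \<le> n \<and> n \<le> (x + r - c) * 2 ^ k" for n :: int
    unfolding eq by (simp only: pos_le_divide_eq pos_divide_le_eq zero_less_power zero_less_numeral)
  show ?thesis
    by (auto simp only: eq2 atLeastAtMost_iff mem_Collect_eq ceiling_le_iff le_floor_iff)
qed

lemma finite_lattice_points: "finite {n::int. \<bar>c + n / 2 ^ k - x\<bar> \<le> r}"
  by (simp add: lattice_points_eq)

text \<open>A closed interval of length t mesh units meets every translate of the lattice in at
  least floor(t) points. For integral t nothing is lost against the average density.\<close>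

lemma lattice_count_ge_floor: "\<lfloor>2 * r * 2 ^ k\<rfloor> \<le> int (lattice_count k c x r)"
proof -
  define y where "y = (x - r - c) * 2 ^ k"
  have "(x + r - c) * 2 ^ k = y + 2 * r * 2 ^ k" by (simp add: y_def algebra_simps)
  moreover have "\<lfloor>2 * r * 2 ^ k\<rfloor> \<le> \<lfloor>y + 2 * r * 2 ^ k\<rfloor> - \<lceil>y\<rceil> + 1" by linarith
  ultimately have "\<lfloor>2 * r * 2 ^ k\<rfloor> \<le> \<lfloor>(x + r - c) * 2 ^ k\<rfloor> - \<lceil>(x - r - c) * 2 ^ k\<rceil> + 1"
    by (simp only: y_def)
  also have "\<dots> \<le> int (lattice_count k c x r)"
    by (simp only: lattice_count_def lattice_points_eq card_atLeastAtMost_int nat_eq_iff)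
  finally show ?thesis .
qed

lemma lattice_count_gt: "2 * r * 2 ^ k - 1 \<le> lattice_count k c x r"
  using lattice_count_ge_floor[of r k c x] by linarith

text \<open>The lattice is shifted by the radius itself. In mesh units one then counts the integers
  in [y - (M + 1/2), y] with y = x 2^k, and the extra point appears when y lies in the first half of
  its unit cell.\<close>

lemma lattice_count_half_integer:
  assumes "2 * r * 2 ^ k = real M + 1/2"
  shows "M + (if frac (x * 2 ^ k) < 1/2 then 1 else 0) \<le> lattice_count k r x r"
proof (cases "frac (x * 2 ^ k) < 1/2")
  case True
  have eq: "(x - r - r) * 2 ^ k = x * 2 ^ k - (real M + 1/2)"
    unfolding assms[symmetric] by (simp add: algebra_simps)
  have "\<lceil>(x - r - r) * 2 ^ k\<rceil> \<le> \<lfloor>x * 2 ^ k\<rfloor> - int M"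
    using True unfolding frac_def eq by linarith
  then have "M + 1 \<le> nat (\<lfloor>x * 2 ^ k\<rfloor> - \<lceil>(x - r - r) * 2 ^ k\<rceil> + 1)" by linarith
  with True show ?thesis by (simp only: lattice_count_def lattice_points_eq) simp
next
  case False
  have "int M \<le> \<lfloor>2 * r * 2 ^ k\<rfloor>" unfolding assms by linarith
  with False lattice_count_ge_floor[of r k r x] show ?thesis by simp
qed

text \<open>Cells start at multiples of the mesh, not at lattice points: shifting each block by its
  own radius makes this alignment the right one.\<close>

definition pattern :: "(nat \<Rightarrow> nat) \<Rightarrow> nat \<Rightarrow> (nat \<Rightarrow> real) \<Rightarrow> nat set" where
  "pattern k n x = {i \<in> {..<n}. frac (x i * 2 ^ k i) < 1/2}"

text \<open>
  Only the parity of the half-cell containing each coordinate matters, so the event that some cube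
  around x is dense becomes a set of subsets of {..<n}.
\<close>

definition dense_at :: "real \<Rightarrow> nat \<Rightarrow> (nat \<Rightarrow> nat) \<Rightarrow> (nat \<Rightarrow> real) \<Rightarrow> real \<Rightarrow> nat set \<Rightarrow> bool" where
  "dense_at T n k c r S \<longleftrightarrow> (\<forall>x. pattern k n x = S \<longrightarrow>
     T * (2 * r) ^ n \<le> (\<Prod>i<n. lattice_count (k i) (c i) (x i) r / 2 ^ k i))"

text \<open>
  The condition that 2 r 2^K is an integer keeps r admissible for all later blocks, whose mesh divides
  2^(-K); q bounds the fraction of bad patterns.
\<close>

definition good_system :: "real \<Rightarrow> real \<Rightarrow> nat \<Rightarrow> nat \<Rightarrow> bool" where
  "good_system T q n K \<longleftrightarrow> (\<exists>k c W (R::real). W \<subseteq> Pow {..<n} \<and> real (card (Pow {..<n} - W)) \<le> q * 2 ^ n \<and>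
     (\<forall>S\<in>W. \<exists>r::real. 0 < r \<and> r \<le> R \<and> (\<exists>j::nat. 2 * r * 2 ^ K = j) \<and> dense_at T n k c r S))"

lemma prod_lessThan_add:
  fixes f :: "nat \<Rightarrow> 'a::comm_monoid_mult"
  shows "(\<Prod>i<n + b. f i) = (\<Prod>i<n. f i) * (\<Prod>i<b. f (n + i))"
  by (induction b) (simp_all add: mult.assoc)

lemma pattern_append:
  assumes "\<And>i. i < n \<Longrightarrow> k' i = k i"
  shows "pattern k' (n + b) x \<inter> {..<n} = pattern k n x"
  using assms by (auto simp: pattern_def)

text \<open>Appends a block of mesh 2^(-K) with its own radius \<open>r'\<close>. A long pattern is
  good if its old part is good, witnessed by the old radius, or if its new part lies in
  \<open>B\<close>, witnessed by \<open>r'\<close>. It is bad only if both parts are bad, so the bad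
  fractions multiply.\<close>

lemma good_system_extend:
  assumes sys: "good_system T q n K" and "T > 0"
    and M: "M \<ge> (2 * n + 1) * 2 ^ K"
    and B: "B \<subseteq> Pow {..<b}"
    and gain: "\<And>S. S \<in> B \<Longrightarrow>
      2 * T * (real M + 1/2) ^ b \<le> (real M + 1) ^ card S * real M ^ (b - card S)"
  shows "good_system T (q * (1 - card B / 2 ^ b)) (n + b) (Suc K)"
proof -
  obtain k c W R where W: "W \<subseteq> Pow {..<n}" "real (card (Pow {..<n} - W)) \<le> q * 2 ^ n"
    and dense: "\<And>S. S \<in> W \<Longrightarrow>
      \<exists>r::real. 0 < r \<and> r \<le> R \<and> (\<exists>j::nat. 2 * r * 2 ^ K = j) \<and> dense_at T n k c r S"
    using sys unfolding good_system_def by blast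
  \<comment> \<open>In units of 2^(-K) the side is a half-integer, so one more halving of the mesh
    makes it integral; thus \<open>Suc K\<close> serves the next block.\<close>
  define r' :: real where "r' = (real M + 1/2) / 2 ^ Suc K"
  have r'K: "2 * r' * 2 ^ K = real M + 1/2" by (simp add: r'_def)
  define k' where "k' i = (if i < n then k i else K)" for i
  define c' where "c' i = (if i < n then c i else r')" for i
  define W' where "W' = {S \<in> Pow {..<n + b}. S \<inter> {..<n} \<in> W \<or> {i. n + i \<in> S} \<in> B}"
  have old: "dense_at T (n + b) k' c' r S"
    if r: "r > 0" "2 * r * 2 ^ K = real j" and d: "dense_at T n k c r (S \<inter> {..<n})" for r S and j :: nat
    unfolding dense_at_def
  proof (intro allI impI)
    fix x assume "pattern k' (n + b) x = S"
    then have "pattern k n x = S \<inter> {..<n}"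
      using pattern_append[of n k' k b x] by (simp add: k'_def)
    then have "T * (2 * r) ^ n \<le> (\<Prod>i<n. lattice_count (k' i) (c' i) (x i) r / 2 ^ k' i)"
      using d by (simp add: dense_at_def k'_def c'_def)
    \<comment> \<open>At an old radius the side is exactly \<open>j\<close> new mesh units, so each
      new coordinate has at least average density.\<close>
    moreover have "2 * r \<le> lattice_count (k' (n + i)) (c' (n + i)) (x (n + i)) r / 2 ^ k' (n + i)" for i
    proof -
      have "real j \<le> lattice_count K r' (x (n + i)) r"
        using lattice_count_ge_floor[of r K r' "x (n + i)"] unfolding r by simp
      then show ?thesis unfolding r(2)[symmetric] by (simp add: k'_def c'_def divide_right_mono pos_le_divide_eq)
    qed
    then have "(\<Prod>i<b. 2 * r)
        \<le> (\<Prod>i<b. lattice_count (k' (n + i)) (c' (n + i)) (x (n + i)) r / 2 ^ k' (n + i))"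
      using r by (intro prod_mono) auto
    ultimately show "T * (2 * r) ^ (n + b)
        \<le> (\<Prod>i<n + b. lattice_count (k' i) (c' i) (x i) r / 2 ^ k' i)"
      using r \<open>T > 0\<close> unfolding prod_lessThan_add power_add mult.assoc[symmetric]
      by (intro mult_mono prod_nonneg) auto
  qed
  have new: "dense_at T (n + b) k' c' r' S" if S: "{i. n + i \<in> S} \<in> B" for S
    unfolding dense_at_def
  proof (intro allI impI)
    fix x assume pat: "pattern k' (n + b) x = S"
    let ?S = "{i. n + i \<in> S}"
    have "real ((2 * n + 1) * 2 ^ K) \<le> real M" using M by (simp only: of_nat_le_iff)
    then have "(2 * real n + 1) * 2 ^ K \<le> 2 * r' * 2 ^ K" unfolding r'K by (simp add: algebra_simps)
    then have r': "2 * real n + 1 \<le> 2 * r'" by simp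
    \<comment> \<open>At the new radius each old coordinate may lose a factor 1 - 1/(2r'). As 2r'
      exceeds 2n, all of them together lose at most 1/2, which the factor \<open>2 * T\<close> in
      \<open>gain\<close> makes up for.\<close>
    have "(1::real) / 2 \<le> 1 + real n * (- (1 / (2 * r')))" using r' by (simp add: field_simps)
    also have "\<dots> \<le> (1 + (- (1 / (2 * r')))) ^ n"
      using r' by (intro Bernoulli_inequality) (simp add: field_simps)
    finally have "1/2 * (2 * r') ^ n \<le> (1 - 1 / (2 * r')) ^ n * (2 * r') ^ n"
      using r' by (intro mult_right_mono) auto
    also have "\<dots> = (2 * r' - 1) ^ n"
    proof -
      have "(1 - 1 / (2 * r')) * (2 * r') = 2 * r' - 1" using r' by (simp add: left_diff_distrib)
      then show ?thesis by (metis power_mult_distrib)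
    qed
    also have "\<dots> = (\<Prod>i<n. 2 * r' - 1)" by simp
    also have "\<dots> \<le> (\<Prod>i<n. lattice_count (k' i) (c' i) (x i) r' / 2 ^ k' i)"
    proof (intro prod_mono conjI)
      fix i
      \<comment> \<open>All meshes are at most 1, so missing one lattice point costs at most 1 in
        length.\<close>
      have "2 * r' * 2 ^ k' i - 2 ^ k' i \<le> 2 * r' * 2 ^ k' i - 1" by simp
      also note lattice_count_gt
      finally show "2 * r' - 1 \<le> lattice_count (k' i) (c' i) (x i) r' / 2 ^ k' i"
        by (simp add: pos_le_divide_eq left_diff_distrib)
    qed (use r' in auto)
    finally have low: "1/2 * (2 * r') ^ n
        \<le> (\<Prod>i<n. lattice_count (k' i) (c' i) (x i) r' / 2 ^ k' i)" .
    have Sb: "?S \<subseteq> {..<b}" using S B by auto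
    have "2 * T * (2 * r') ^ b = 2 * T * (real M + 1/2) ^ b / (2 ^ K) ^ b"
      unfolding r'K[symmetric] by (simp add: power_mult_distrib)
    also have "\<dots> \<le> (real M + 1) ^ card ?S * real M ^ (b - card ?S) / (2 ^ K) ^ b"
      by (intro divide_right_mono gain S) simp
    also have "\<dots> = (\<Prod>i<b. (if i \<in> ?S then real M + 1 else real M) / 2 ^ K)"
    proof -
      have "{..<b} \<inter> ?S = ?S" "card ({..<b} \<inter> - ?S) = b - card ?S"
        using Sb by (auto simp: card_Diff_subset finite_subset Diff_eq[symmetric])
      then show ?thesis by (simp add: prod_dividef prod.If_cases)
    qed
    also have "\<dots> \<le> (\<Prod>i<b. lattice_count (k' (n + i)) (c' (n + i)) (x (n + i)) r' / 2 ^ k' (n + i))"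
    proof (intro prod_mono conjI)
      fix i assume i: "i \<in> {..<b}"
      then have "i \<in> ?S \<longleftrightarrow> frac (x (n + i) * 2 ^ K) < 1/2"
        using pat by (auto simp: pattern_def k'_def)
      then have "(if i \<in> ?S then real M + 1 else real M) \<le> lattice_count K r' (x (n + i)) r'"
        using lattice_count_half_integer[OF r'K, of "x (n + i)"] by (auto split: if_splits)
      then show "(if i \<in> ?S then real M + 1 else real M) / 2 ^ K
          \<le> lattice_count (k' (n + i)) (c' (n + i)) (x (n + i)) r' / 2 ^ k' (n + i)"
        by (simp add: k'_def c'_def divide_right_mono)
    qed auto
    finally have high: "2 * T * (2 * r') ^ b
        \<le> (\<Prod>i<b. lattice_count (k' (n + i)) (c' (n + i)) (x (n + i)) r' / 2 ^ k' (n + i))" .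
    have "T * (2 * r') ^ (n + b) = (1/2 * (2 * r') ^ n) * (2 * T * (2 * r') ^ b)"
      by (simp add: power_add)
    also have "\<dots> \<le> (\<Prod>i<n + b. lattice_count (k' i) (c' i) (x i) r' / 2 ^ k' i)"
      unfolding prod_lessThan_add using low high r' \<open>T > 0\<close>
      by (intro mult_mono prod_nonneg) auto
    finally show "T * (2 * r') ^ (n + b)
        \<le> (\<Prod>i<n + b. lattice_count (k' i) (c' i) (x i) r' / 2 ^ k' i)" .
  qed
  have "Pow {..<n + b} - W' = (\<lambda>(S, R). join n S R) ` ((Pow {..<n} - W) \<times> (Pow {..<b} - B))"
  proof (intro equalityI subsetI)
    fix S assume S: "S \<in> Pow {..<n + b} - W'"
    then show "S \<in> (\<lambda>(S, R). join n S R) ` ((Pow {..<n} - W) \<times> (Pow {..<b} - B))"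
      by (intro image_eqI[of _ _ "(S \<inter> {..<n}, {i. n + i \<in> S})"])
         (auto simp: join_restrict W'_def)
  next
    fix S assume "S \<in> (\<lambda>(S, R). join n S R) ` ((Pow {..<n} - W) \<times> (Pow {..<b} - B))"
    then show "S \<in> Pow {..<n + b} - W'"
      by (auto simp: W'_def join_left join_right) (auto simp: join_def)
  qed
  then have "card (Pow {..<n + b} - W') \<le> card (Pow {..<n} - W) * card (Pow {..<b} - B)"
    by (metis card_image_le card_cartesian_product finite_Diff finite_Pow_iff finite_cartesian_product
        finite_lessThan)
  then have "real (card (Pow {..<n + b} - W')) \<le> card (Pow {..<n} - W) * real (card (Pow {..<b} - B))"
    by (metis of_nat_le_iff of_nat_mult)
  also have "\<dots> \<le> q * 2 ^ n * real (card (Pow {..<b} - B))"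
    using W by (intro mult_right_mono) auto
  also have "real (card (Pow {..<b} - B)) = 2 ^ b - real (card B)"
    using B card_mono[OF _ B] by (simp add: card_Diff_subset finite_subset card_Pow of_nat_diff)
  also have "q * 2 ^ n * (2 ^ b - real (card B)) = q * (1 - card B / 2 ^ b) * 2 ^ (n + b)"
    by (simp add: field_simps power_add)
  finally have cardW': "real (card (Pow {..<n + b} - W')) \<le> q * (1 - card B / 2 ^ b) * 2 ^ (n + b)" .
  have "\<exists>r::real. 0 < r \<and> r \<le> max R r' \<and> (\<exists>j::nat. 2 * r * 2 ^ Suc K = j) \<and> dense_at T (n + b) k' c' r S"
    if "S \<in> W'" for S
  proof (cases "S \<inter> {..<n} \<in> W")
    case True
    then obtain r j where r: "0 < r" "r \<le> R" "2 * r * 2 ^ K = real j" "dense_at T n k c r (S \<inter> {..<n})"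
      using dense by blast
    then have "2 * r * 2 ^ Suc K = real (2 * j)" by simp
    with r(1,2) old[OF r(1,3,4)] show ?thesis by (intro exI[of _ r] conjI exI[of _ "2 * j"]) simp_all
  next
    case False
    with that have "{i. n + i \<in> S} \<in> B" by (auto simp: W'_def)
    moreover have "2 * r' * 2 ^ Suc K = real (2 * M + 1)" by (simp add: r'_def)
    moreover have "r' > 0" by (simp add: r'_def add_nonneg_pos)
    ultimately show ?thesis using new 
      by (intro exI[of _ r'] conjI exI[of _ "2 * M + 1"]) simp_all
  qed
  moreover have "W' \<subseteq> Pow {..<n + b}" by (auto simp: W'_def)
  ultimately show ?thesis using cardW' unfolding good_system_def by blast
qed

lemma good_system_mono: "good_system T q n K \<Longrightarrow> q \<le> q' \<Longrightarrow> good_system T q' n K"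
proof -
  assume sys: "good_system T q n K" and q: "q \<le> q'"
  have "q * 2 ^ n \<le> q' * 2 ^ n" using q by (intro mult_right_mono) auto
  with sys show ?thesis unfolding good_system_def by (meson order_trans)
qed

text \<open>Each new block multiplies the bad fraction by at most 1 - p. Because \<open>p\<close> is
  fixed beforehand, \<open>M\<close> may be chosen after the dimension and mesh of the system built
  so far.\<close>

lemma good_system_exists:
  assumes "T > 0"
  shows "\<exists>D. \<forall>d\<ge>D. \<exists>K. good_system T (1/2) d K"
proof -
  obtain p :: real where p: "p > 0" "p \<le> 1"
    and block: "\<And>M0. \<exists>M b B. M \<ge> M0 \<and> M > 0 \<and> B \<subseteq> Pow {..<b} \<and> p * 2 ^ b \<le> card B \<and>
      (\<forall>S\<in>B. 2 * T * (real M + 1/2) ^ b \<le> (real M + 1) ^ card S * real M ^ (b - card S))"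
    using block_exists[of "2 * T"] assms by (metis mult_pos_pos zero_less_numeral)
  have sys: "\<exists>n K. good_system T ((1 - p) ^ j) n K" for j
  proof (induction j)
    case 0
    \<comment> \<open>Dimension 0 with no good pattern at all: bad fraction 1.\<close>
    have "good_system T 1 0 0" unfolding good_system_def
      by (intro exI[of _ "\<lambda>_. 0"] exI[of _ "{}"] exI[of _ 0]) auto
    then show ?case by auto
  next
    case (Suc j)
    then obtain n K where s: "good_system T ((1 - p) ^ j) n K" by blast
    obtain M b B where "M \<ge> (2 * n + 1) * 2 ^ K" "B \<subseteq> Pow {..<b}" and cB: "p * 2 ^ b \<le> card B"
      and "\<forall>S\<in>B. 2 * T * (real M + 1/2) ^ b \<le> (real M + 1) ^ card S * real M ^ (b - card S)"
      using block[of "(2 * n + 1) * 2 ^ K"] by blast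
    then have "good_system T ((1 - p) ^ j * (1 - card B / 2 ^ b)) (n + b) (Suc K)"
      by (intro good_system_extend s assms) auto
    moreover have "(1 - p) ^ j * (1 - card B / 2 ^ b) \<le> (1 - p) ^ j * (1 - p)"
      using p cB by (intro mult_left_mono) (auto simp: field_simps)
    ultimately have "good_system T ((1 - p) ^ Suc j) (n + b) (Suc K)"
      by (auto intro: good_system_mono simp: mult.commute)
    then show ?case by blast
  qed
  obtain j where "(1 - p) ^ j < 1/2" using real_arch_pow_inv[of "1/2" "1 - p"] p by auto
  with sys[of j] obtain n K where s: "good_system T (1/2) n K"
    by (meson good_system_mono less_imp_le)
  \<comment> \<open>Padding to an arbitrary larger dimension: a block with empty \<open>B\<close>
    leaves the bad fraction unchanged.\<close>
  have "good_system T (1/2) d (Suc K)" if "d \<ge> n" for d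
    using good_system_extend[OF s assms order_refl, of "{}" "d - n"] that by simp
  then show ?thesis by blast
qed

section \<open>From lattices to integrable functions\<close>

interpretation lebd: product_sigma_finite "\<lambda>_::nat. lborel :: real measure"
  by standard

lemma space_lebd: "space (lebd d) = PiE {..<d} (\<lambda>_. UNIV)"
  by (simp add: lebd_def space_PiM)

lemma cube_eq: "cube d x r = PiE {..<d} (\<lambda>i. {x i - r..x i + r})"
proof -
  have eq: "\<bar>y i - x i\<bar> \<le> r \<longleftrightarrow> y i \<in> {x i - r..x i + r}" for y :: "nat \<Rightarrow> real" and i
    by auto
  show ?thesis
    unfolding cube_def space_lebd eq by (rule set_eqI) (simp only: mem_Collect_eq PiE_iff lessThan_iff UNIV_I, blast)
qed

lemma emeasure_lebd_PiE:
  "(\<And>i. i < d \<Longrightarrow> A i \<in> sets borel) \<Longrightarrow>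
     emeasure (lebd d) (PiE {..<d} A) = (\<Prod>i<d. emeasure lborel (A i))"
  unfolding lebd_def by (rule lebd.emeasure_PiM) auto

lemma emeasure_cube: "r \<ge> 0 \<Longrightarrow> emeasure (lebd d) (cube d x r) = ennreal ((2 * r) ^ d)"
  by (simp add: cube_eq emeasure_lebd_PiE ennreal_power)

lemma sigma_finite_lebd: "sigma_finite_measure (lebd d)"
  unfolding lebd_def by (rule lebd.sigma_finite) simp

section \<open>Measurability of the maximal function\<close>

definition cube_mass :: "nat \<Rightarrow> ((nat \<Rightarrow> real) \<Rightarrow> real) \<Rightarrow> real \<Rightarrow> (nat \<Rightarrow> real) \<Rightarrow> ennreal" where
  "cube_mass d f r x = (\<integral>\<^sup>+ y\<in>cube d x r. ennreal \<bar>f y\<bar> \<partial>lebd d)"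

lemma cube_mass_measurable:
  assumes [measurable]: "f \<in> borel_measurable (lebd d)"
  shows "cube_mass d f r \<in> borel_measurable (lebd d)"
proof -
  interpret sigma_finite_measure "lebd d" by (rule sigma_finite_lebd)
  have [measurable]: "(\<lambda>x. x i) \<in> borel_measurable (lebd d)" if "i \<in> {..<d}" for i
    using that unfolding lebd_def by (metis measurable_component_singleton measurable_lborel1)
  \<comment> \<open>Written as a finite conjunction of coordinate conditions, the integrand is
    visibly jointly measurable in \<open>x\<close> and \<open>y\<close>.\<close>
  have "(\<lambda>x. \<integral>\<^sup>+ y. (if \<forall>i\<in>{..<d}. \<bar>y i - x i\<bar> \<le> r then ennreal \<bar>f y\<bar> else 0) \<partial>lebd d)
      \<in> borel_measurable (lebd d)"
    by measurable
  also have "(\<lambda>x. \<integral>\<^sup>+ y. (if \<forall>i\<in>{..<d}. \<bar>y i - x i\<bar> \<le> r then ennreal \<bar>f y\<bar> else 0) \<partial>lebd d)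
      = cube_mass d f r"
    unfolding cube_mass_def by (intro ext nn_integral_cong) (auto simp: cube_def indicator_def)
  finally show ?thesis .
qed

lemma cube_mass_mono: "r \<le> s \<Longrightarrow> cube_mass d f r x \<le> cube_mass d f s x"
  unfolding cube_mass_def
  by (intro nn_integral_mono mult_left_mono) (auto simp: cube_def indicator_def split: if_splits)

lemma maxfun_eq_SUP:
  "maxfun d f x = (SUP r\<in>{0<..}. cube_mass d f r x / ennreal ((2 * r) ^ d))"
  unfolding maxfun_def cube_mass_def by (intro SUP_cong) (auto simp: emeasure_cube)

text \<open>A cube of radius \<open>r\<close> lies in the cubes of rational radius q > r, whose
  volumes tend to its own as q decreases to \<open>r\<close>. The supremum thus becomes
  countable.\<close>

lemma maxfun_eq_SUP_Rats:
  "maxfun d f x = (SUP r\<in>{0<..} \<inter> \<rat>. cube_mass d f r x / ennreal ((2 * r) ^ d))" (is "_ = ?S")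
proof (rule antisym)
  show "maxfun d f x \<le> ?S"
    unfolding maxfun_eq_SUP
  proof (rule SUP_least)
    fix r :: real assume "r \<in> {0<..}"
    then have r: "r > 0" by simp
    show "cube_mass d f r x / ennreal ((2 * r) ^ d) \<le> ?S"
    proof (cases ?S)
      case (real s)
      have le: "cube_mass d f r x \<le> ennreal (s * (2 * q) ^ d)" if "r \<le> q" "q \<in> \<rat>" for q
      proof -
        have q: "q > 0" using that r by simp
        have "cube_mass d f q x = cube_mass d f q x / ennreal ((2 * q) ^ d) * ennreal ((2 * q) ^ d)"
          using q by (simp add: ennreal_divide_times)
        also have "\<dots> \<le> ?S * ennreal ((2 * q) ^ d)"
          using that q by (intro mult_right_mono SUP_upper) auto
        finally have "cube_mass d f q x \<le> ennreal s * ennreal ((2 * q) ^ d)" by (simp only: real)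
        with cube_mass_mono[OF \<open>r \<le> q\<close>, of d f x] q real show ?thesis
          by (simp add: ennreal_mult)
      qed
      \<comment> \<open>A single larger rational cube already shows that the mass is finite, so the
        limit can be taken in the reals.\<close>
      obtain q0 where "r < q0" "q0 \<in> \<rat>" using Rats_dense_in_real[of r "r + 1"] by auto
      then have "cube_mass d f r x < \<infinity>" using le[of q0] by (auto simp: less_top[symmetric] top_unique)
      then obtain a where a: "a \<ge> 0" "cube_mass d f r x = ennreal a"
        by (cases "cube_mass d f r x") auto
      have "a \<le> s * (2 * r) ^ d"
      proof (rule ccontr)
        assume "\<not> ?thesis"
        moreover have "((\<lambda>q. s * (2 * q) ^ d) \<longlongrightarrow> s * (2 * r) ^ d) (at_right r)"
          by (intro tendsto_intros)
        ultimately have "eventually (\<lambda>q. s * (2 * q) ^ d < a) (at_right r)"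
          by (intro order_tendstoD) auto
        then obtain b where "b > r" "\<And>q. r < q \<Longrightarrow> q < b \<Longrightarrow> s * (2 * q) ^ d < a"
          unfolding eventually_at_right_field by auto
        moreover obtain q where "r < q" "q < b" "q \<in> \<rat>" using Rats_dense_in_real \<open>b > r\<close> by blast
        moreover have "a \<le> s * (2 * q) ^ d"
          using le[of q] \<open>r < q\<close> \<open>q \<in> \<rat>\<close> real r a by (simp add: ennreal_le_iff)
        ultimately show False by fastforce
      qed
      then show ?thesis using a real r
        by (simp add: divide_ennreal pos_divide_le_eq)
    next
      case top
      then show ?thesis by (simp only: top_greatest)
    qed
  qed
next
  show "?S \<le> maxfun d f x"
    unfolding maxfun_eq_SUP by (rule SUP_subset_mono) auto
qed

text \<open>\<open>emeasure\<close> is 0 on nonmeasurable sets, so a lower bound for the measure of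
  a superlevel set by inclusion requires this.\<close>

lemma maxfun_measurable:
  assumes "f \<in> borel_measurable (lebd d)"
  shows "maxfun d f \<in> borel_measurable (lebd d)"
proof -
  have "countable ({0<..} \<inter> \<rat> :: real set)"
    using countable_rat by (auto intro: countable_subset)
  moreover have "(\<lambda>x. cube_mass d f r x / ennreal ((2 * r) ^ d)) \<in> borel_measurable (lebd d)" for r
    using cube_mass_measurable[OF assms, of r] by measurable
  ultimately have "(\<lambda>x. SUP r\<in>{0<..} \<inter> \<rat>. cube_mass d f r x / ennreal ((2 * r) ^ d))
      \<in> borel_measurable (lebd d)"
    by (intro borel_measurable_SUP) auto
  then show ?thesis by (simp add: maxfun_eq_SUP_Rats[abs_def])
qed

section \<open>Smeared lattice measures and their products\<close>

text \<open>Masses 2^(-k) at the lattice points with index in \<open>J\<close>, each spread evenly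
  over length \<delta> to its right. This is normalised to one unit of mass per unit length;
  overlaps simply add up.\<close>

definition comb :: "nat \<Rightarrow> real \<Rightarrow> real \<Rightarrow> int set \<Rightarrow> real \<Rightarrow> real" where
  "comb k c \<delta> J y = (\<Sum>n\<in>J. 1 / (\<delta> * 2 ^ k) * indicator {c + n / 2 ^ k..c + n / 2 ^ k + \<delta>} y)"

lemma comb_nonneg: "\<delta> > 0 \<Longrightarrow> comb k c \<delta> J y \<ge> 0"
  unfolding comb_def by (intro sum_nonneg mult_nonneg_nonneg) auto

lemma comb_measurable [measurable]: "comb k c \<delta> J \<in> borel_measurable borel"
  unfolding comb_def by measurable

lemma has_bochner_integral_comb:
  assumes "\<delta> > 0"
  shows "has_bochner_integral lborel (comb k c \<delta> J) (card J / 2 ^ k)"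
proof -
  have "has_bochner_integral lborel (comb k c \<delta> J) (\<Sum>n\<in>J. 1 / (\<delta> * 2 ^ k) * \<delta>)"
    unfolding comb_def
  proof (intro has_bochner_integral_sum has_bochner_integral_mult_right)
    fix n :: int
    show "has_bochner_integral lborel (indicator {c + n / 2 ^ k..c + n / 2 ^ k + \<delta>}) \<delta>"
      using has_bochner_integral_real_indicator[of "{c + n / 2 ^ k..c + n / 2 ^ k + \<delta>}" lborel] assms
      by simp
  qed
  then show ?thesis using assms by simp
qed

text \<open>Smearing moves mass by at most \<delta>, so enlarging the radius by \<delta> recovers
  all the mass of the lattice points within \<open>r\<close>.\<close>

lemma comb_mass_ge:
  assumes \<delta>: "\<delta> > 0" and J: "{n::int. \<bar>c + n / 2 ^ k - x\<bar> \<le> r} \<subseteq> J" and fin: "finite J"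
  shows "ennreal (lattice_count k c x r / 2 ^ k)
    \<le> (\<integral>\<^sup>+ y. ennreal (comb k c \<delta> J y) * indicator {x - (r + \<delta>)..x + (r + \<delta>)} y \<partial>lborel)"
proof -
  let ?A = "{n::int. \<bar>c + n / 2 ^ k - x\<bar> \<le> r}"
  have "ennreal (lattice_count k c x r / 2 ^ k) = (\<integral>\<^sup>+ y. ennreal (comb k c \<delta> ?A y) \<partial>lborel)"
    using has_bochner_integral_comb[OF \<delta>, of k c ?A] comb_nonneg[OF \<delta>]
    by (subst nn_integral_eq_integral)
       (auto simp: has_bochner_integral_iff lattice_count_def)
  also have "\<dots> \<le> (\<integral>\<^sup>+ y. ennreal (comb k c \<delta> J y) * indicator {x - (r + \<delta>)..x + (r + \<delta>)} y \<partial>lborel)"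
  proof (rule nn_integral_mono)
    fix y
    show "ennreal (comb k c \<delta> ?A y)
        \<le> ennreal (comb k c \<delta> J y) * indicator {x - (r + \<delta>)..x + (r + \<delta>)} y"
    proof (cases "y \<in> {x - (r + \<delta>)..x + (r + \<delta>)}")
      case True
      have "comb k c \<delta> ?A y \<le> comb k c \<delta> J y"
        unfolding comb_def using fin J \<delta> by (intro sum_mono2) auto
      with True show ?thesis by (simp add: ennreal_leI)
    next
      case False
      have "y \<notin> {c + n / 2 ^ k..c + n / 2 ^ k + \<delta>}" if "n \<in> ?A" for n :: int
        using that False \<delta> by auto
      then have "comb k c \<delta> ?A y = 0" unfolding comb_def by (intro sum.neutral) simp
      then show ?thesis by simp
    qed
  qed
  finally show ?thesis .
qed

lemma prod_mono_ennreal: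
  fixes f g :: "'a \<Rightarrow> ennreal"
  shows "(\<And>i. i \<in> A \<Longrightarrow> f i \<le> g i) \<Longrightarrow> prod f A \<le> prod g A"
  by (induction A rule: infinite_finite_induct) (auto intro: mult_mono)

definition comb_prod :: "nat \<Rightarrow> (nat \<Rightarrow> nat) \<Rightarrow> (nat \<Rightarrow> real) \<Rightarrow> real \<Rightarrow> (nat \<Rightarrow> int set) \<Rightarrow> (nat \<Rightarrow> real) \<Rightarrow> real" where
  "comb_prod d k c \<delta> J y = (\<Prod>i<d. comb (k i) (c i) \<delta> (J i) (y i))"

lemma comb_prod_integrable:
  assumes "\<delta> > 0"
  shows "integrable (lebd d) (comb_prod d k c \<delta> J)"
  unfolding lebd_def comb_prod_def using has_bochner_integral_comb[OF assms]
  by (intro lebd.product_integrable_prod) (auto simp: has_bochner_integral_iff)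

lemma comb_prod_nonneg: "\<delta> > 0 \<Longrightarrow> comb_prod d k c \<delta> J y \<ge> 0"
  unfolding comb_prod_def by (intro prod_nonneg) (auto simp: comb_nonneg)

lemma comb_prod_integral:
  assumes "\<delta> > 0"
  shows "(\<integral>y. \<bar>comb_prod d k c \<delta> J y\<bar> \<partial>lebd d) = (\<Prod>i<d. card (J i) / 2 ^ k i)"
proof -
  have "(\<integral>y. \<bar>comb_prod d k c \<delta> J y\<bar> \<partial>lebd d)
      = (\<integral>y. (\<Prod>i<d. comb (k i) (c i) \<delta> (J i) (y i)) \<partial>lebd d)"
    using comb_prod_nonneg[OF assms] by (simp add: comb_prod_def)
  also have "\<dots> = (\<Prod>i<d. integral\<^sup>L lborel (comb (k i) (c i) \<delta> (J i)))"
    unfolding lebd_def using has_bochner_integral_comb[OF assms]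
    by (intro lebd.product_integral_prod) (auto simp: has_bochner_integral_iff)
  finally show ?thesis
    using has_bochner_integral_comb[OF assms] by (simp add: has_bochner_integral_iff)
qed

text \<open>Density and cube are both products over the coordinates, so Tonelli reduces the claim to
  one dimension.\<close>

lemma comb_prod_cube_mass_ge:
  assumes \<delta>: "\<delta> > 0" and fin: "\<And>i. i < d \<Longrightarrow> finite (J i)"
    and J: "\<And>i. i < d \<Longrightarrow> {n::int. \<bar>c i + n / 2 ^ k i - x i\<bar> \<le> r} \<subseteq> J i"
  shows "ennreal (\<Prod>i<d. lattice_count (k i) (c i) (x i) r / 2 ^ k i)
    \<le> cube_mass d (comb_prod d k c \<delta> J) (r + \<delta>) x"
proof -
  let ?g = "\<lambda>i y. ennreal (comb (k i) (c i) \<delta> (J i) y) * indicator {x i - (r + \<delta>)..x i + (r + \<delta>)} y"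
  have "ennreal (\<Prod>i<d. lattice_count (k i) (c i) (x i) r / 2 ^ k i)
      = (\<Prod>i<d. ennreal (lattice_count (k i) (c i) (x i) r / 2 ^ k i))"
    by (simp add: prod_ennreal)
  also have "\<dots> \<le> (\<Prod>i<d. \<integral>\<^sup>+ y. ?g i y \<partial>lborel)"
    by (intro prod_mono_ennreal) (auto intro!: comb_mass_ge \<delta> fin J)
  also have "\<dots> = (\<integral>\<^sup>+ y. (\<Prod>i<d. ?g i (y i)) \<partial>lebd d)"
    unfolding lebd_def by (subst lebd.product_nn_integral_prod) auto
  also have "\<dots> = cube_mass d (comb_prod d k c \<delta> J) (r + \<delta>) x"
    unfolding cube_mass_def
  proof (rule nn_integral_cong)
    fix y assume "y \<in> space (lebd d)"
    then have "(\<Prod>i<d. indicator {x i - (r + \<delta>)..x i + (r + \<delta>)} (y i))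
        = (indicator (cube d x (r + \<delta>)) y :: ennreal)"
      by (auto simp: cube_eq indicator_def space_lebd PiE_iff prod_eq_1_iff)
    then show "(\<Prod>i<d. ?g i (y i))
        = ennreal \<bar>comb_prod d k c \<delta> J y\<bar> * indicator (cube d x (r + \<delta>)) y"
      using comb_nonneg[OF \<delta>] comb_prod_nonneg[OF \<delta>]
      by (simp add: prod.distrib prod_ennreal comb_prod_def)
  qed
  finally show ?thesis .
qed

lemma lattice_count_le:
  assumes "r \<ge> 0"
  shows "lattice_count k c x r / 2 ^ k \<le> 2 * r + 1"
proof -
  define y where "y = (x - r - c) * 2 ^ k"
  have u: "2 * r * 2 ^ k \<ge> 0" using assms by simp
  have eq: "(x + r - c) * 2 ^ k = y + 2 * r * 2 ^ k" by (simp add: y_def algebra_simps)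
  have "real (nat (\<lfloor>y + 2 * r * 2 ^ k\<rfloor> - \<lceil>y\<rceil> + 1)) \<le> 2 * r * 2 ^ k + 1"
    using u by linarith
  then have "lattice_count k c x r \<le> 2 * r * 2 ^ k + 1"
    unfolding lattice_count_def lattice_points_eq eq y_def[symmetric] by simp
  also have "\<dots> \<le> (2 * r + 1) * 2 ^ k" by (simp add: distrib_right)
  finally show ?thesis by (simp add: pos_divide_le_eq)
qed

section \<open>Volume occupied by a set of patterns\<close>

definition half_cells :: "nat \<Rightarrow> nat \<Rightarrow> bool \<Rightarrow> real set" where
  "half_cells k N b = {x \<in> {0..<real N}. frac (x * 2 ^ k) < 1/2 \<longleftrightarrow> b}"

lemma half_cells_True_eq:
  "half_cells k N True = (\<Union>m<N * 2 ^ k. {real m / 2 ^ k..<(real m + 1/2) / 2 ^ k})"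
proof (intro equalityI subsetI)
  fix x assume "x \<in> half_cells k N True"
  then have x: "0 \<le> x" "x < real N" "frac (x * 2 ^ k) < 1/2" by (auto simp: half_cells_def)
  define m where "m = nat \<lfloor>x * 2 ^ k\<rfloor>"
  have m: "real m = of_int \<lfloor>x * 2 ^ k\<rfloor>" using x by (simp add: m_def)
  have 1: "real m \<le> x * 2 ^ k" "x * 2 ^ k < real m + 1/2" using x(3) unfolding m frac_def by linarith+
  have "x * 2 ^ k < real N * 2 ^ k" using x by simp
  then have "real m < real N * 2 ^ k" using 1 by linarith
  also have "real N * 2 ^ k = real (N * 2 ^ k)" by simp
  finally have "m < N * 2 ^ k" by (simp only: of_nat_less_iff)
  with 1 show "x \<in> (\<Union>m<N * 2 ^ k. {real m / 2 ^ k..<(real m + 1/2) / 2 ^ k})"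
    by (auto simp: pos_divide_le_eq pos_less_divide_eq)
next
  fix x assume "x \<in> (\<Union>m<N * 2 ^ k. {real m / 2 ^ k..<(real m + 1/2) / 2 ^ k})"
  then obtain m where "m < N * 2 ^ k" and m: "real m \<le> x * 2 ^ k" "x * 2 ^ k < real m + 1/2"
    by (auto simp: pos_divide_le_eq pos_less_divide_eq)
  then have "real m + 1 \<le> real (N * 2 ^ k)" by (simp only: flip: of_nat_Suc)
  then have "real m + 1 \<le> real N * 2 ^ k" by simp
  then have "x * 2 ^ k < real N * 2 ^ k" using m by linarith
  then have "x < real N" by simp
  moreover have "0 \<le> x * 2 ^ k" using m by linarith
  then have "0 \<le> x" using mult_neg_pos[of x "2 ^ k"] by (cases "x < 0") auto
  moreover have "\<lfloor>x * 2 ^ k\<rfloor> = int m" using m by linarith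
  then have "frac (x * 2 ^ k) < 1/2" using m unfolding frac_def by simp
  ultimately show "x \<in> half_cells k N True" by (simp add: half_cells_def)
qed

lemma half_cells_False_eq: "half_cells k N False = {0..<real N} - half_cells k N True"
  by (auto simp: half_cells_def)

lemma half_cells_measurable [measurable]: "half_cells k N b \<in> sets borel"
  by (cases b) (simp_all add: half_cells_False_eq half_cells_True_eq)

text \<open>As \<open>N\<close> is an integer, whole cells fill the interval for every mesh, and
  each splits into equal halves.\<close>

lemma emeasure_half_cells: "emeasure lborel (half_cells k N b) = ennreal (real N / 2)"
proof -
  have disj: "disjoint_family_on (\<lambda>m. {real m / 2 ^ k..<(real m + 1/2) / 2 ^ k}) {..<N * 2 ^ k}"
    unfolding disjoint_family_on_def
  proof (intro ballI impI)
    fix m n :: nat assume "m \<noteq> n"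
    then have "real m + 1 \<le> real n \<or> real n + 1 \<le> real m" by linarith
    then show "{real m / 2 ^ k..<(real m + 1/2) / 2 ^ k} \<inter> {real n / 2 ^ k..<(real n + 1/2) / 2 ^ k} = {}"
      by (auto simp: pos_divide_le_eq pos_less_divide_eq)
  qed
  have "emeasure lborel (half_cells k N True)
      = (\<Sum>m<N * 2 ^ k. emeasure lborel {real m / 2 ^ k..<(real m + 1/2) / 2 ^ k})"
    unfolding half_cells_True_eq by (rule sum_emeasure[symmetric]) (use disj in auto)
  also have "\<dots> = (\<Sum>m<N * 2 ^ k. ennreal (1 / 2 / 2 ^ k))"
    by (intro sum.cong) (simp_all add: divide_right_mono add_divide_distrib)
  also have "\<dots> = ennreal (real N / 2)"
    by (simp add: ennreal_of_nat_eq_real_of_nat ennreal_mult[symmetric] del: ennreal_half)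
  finally have T: "emeasure lborel (half_cells k N True) = ennreal (real N / 2)" .
  have sub: "half_cells k N True \<subseteq> {0..<real N}" by (auto simp: half_cells_def)
  have "emeasure lborel (half_cells k N False) = ennreal (real N) - ennreal (real N / 2)"
    unfolding half_cells_False_eq
    by (subst emeasure_Diff) (use T sub half_cells_measurable in auto)
  also have "\<dots> = ennreal (real N / 2)" by (subst ennreal_minus) auto
  finally show ?thesis using T by (cases b) simp_all
qed

text \<open>Each pattern occupies a product of half-cell sets of volume (N/2)^d, whatever the
  meshes. Proportions of patterns are therefore proportions of volume.\<close>

lemma emeasure_pattern_set:
  fixes k :: "nat \<Rightarrow> nat" and N :: nat
  assumes "W \<subseteq> Pow {..<d}"
  defines "G \<equiv> {x \<in> PiE {..<d} (\<lambda>_. {0..<real N}). pattern k d x \<in> W}"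
  shows "G \<in> sets (lebd d)" and "emeasure (lebd d) G = ennreal (card W * (real N / 2) ^ d)"
proof -
  let ?P = "\<lambda>S. PiE {..<d} (\<lambda>i. half_cells (k i) N (i \<in> S))"
  have P_iff: "x \<in> ?P S \<longleftrightarrow> x \<in> PiE {..<d} (\<lambda>_. {0..<real N}) \<and> pattern k d x = S" if "S \<in> W" for x S
  proof -
    define q where "q i \<longleftrightarrow> frac (x i * 2 ^ k i) < 1/2" for i
    have eq: "{i \<in> {..<d}. q i} = S \<longleftrightarrow> (\<forall>i\<in>{..<d}. q i \<longleftrightarrow> i \<in> S)"
      using that assms(1) by auto
    show ?thesis
      unfolding pattern_def half_cells_def PiE_iff mem_Collect_eq q_def[symmetric] eq ball_conj_distrib
      by (simp only: conj_ac)
  qed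
  have G: "G = (\<Union>S\<in>W. ?P S)"
    by (rule set_eqI) (simp only: G_def mem_Collect_eq UN_iff P_iff cong: bex_cong, blast)
  have disj: "disjoint_family_on ?P W"
    unfolding disjoint_family_on_def
  proof (intro ballI impI equals0I)
    fix S S' x assume "S \<in> W" "S' \<in> W" "S \<noteq> S'" "x \<in> ?P S \<inter> ?P S'"
    then have "pattern k d x = S" "pattern k d x = S'"
      using P_iff[of S x] P_iff[of S' x] by blast+
    with \<open>S \<noteq> S'\<close> show False by simp
  qed
  have fin: "finite W" using assms(1) finite_subset by blast
  have P: "?P S \<in> sets (lebd d)" for S
    unfolding lebd_def by (intro sets_PiM_I_finite) auto
  then show "G \<in> sets (lebd d)" unfolding G using fin by auto
  have "emeasure (lebd d) G = (\<Sum>S\<in>W. emeasure (lebd d) (?P S))"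
    unfolding G by (rule sum_emeasure[symmetric]) (use P disj fin in auto)
  also have "\<dots> = (\<Sum>S\<in>W. ennreal ((real N / 2) ^ d))"
    by (simp add: emeasure_lebd_PiE emeasure_half_cells ennreal_power)
  finally show "emeasure (lebd d) G = ennreal (card W * (real N / 2) ^ d)"
    by (simp add: ennreal_of_nat_eq_real_of_nat ennreal_mult)
qed

section \<open>Lower bound for the weak type constant\<close>

lemma exists_power_le_two: "\<exists>e>0. (1 + e) ^ d \<le> (2::real)"
proof -
  define e :: real where "e = 1 / (2 * (real d + 1))"
  have e: "e > 0" "e \<le> 1/2" by (auto simp: e_def field_simps)
  \<comment> \<open>Bernoulli bounds (1 - e)^d from below by 1/2, and (1 + e)(1 - e) \<le> 1
    transfers this to an upper bound for (1 + e)^d.\<close>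
  have "1/2 \<le> 1 + real d * (- e)" by (simp add: e_def field_simps)
  also have "\<dots> \<le> (1 + (- e)) ^ d" using e by (intro Bernoulli_inequality) simp
  finally have "(1 + e) ^ d * (1/2) \<le> (1 + e) ^ d * (1 - e) ^ d"
    using e by (intro mult_left_mono) simp_all
  also have "\<dots> = (1 - e ^ 2) ^ d"
  proof -
    have "(1 + e) * (1 - e) = 1 - e ^ 2" by (simp add: power2_eq_square algebra_simps)
    then show ?thesis by (metis power_mult_distrib)
  qed
  also have "\<dots> \<le> 1" using power_le_one[of e 2] e by (intro power_le_one) simp_all
  finally have "(1 + e) ^ d \<le> 2" by linarith
  with e show ?thesis by blast
qed

text \<open>The 8 collects three factors of 2: for the enlarged radius r + \<delta>, for the bad
  patterns, and for the mass of \<open>f\<close> outside the box of side \<open>N\<close>.\<close>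

lemma weak11_const_ge:
  assumes sys: "good_system T (1/2) d K" and "T > 0" and weak: "weak11 d C" and "C > 0"
  shows "T / 8 \<le> C"
proof -
  obtain k c W R0 where W: "W \<subseteq> Pow {..<d}" "real (card (Pow {..<d} - W)) \<le> 1/2 * 2 ^ d"
    and dense0: "\<And>S. S \<in> W \<Longrightarrow>
      \<exists>r::real. 0 < r \<and> r \<le> R0 \<and> (\<exists>j::nat. 2 * r * 2 ^ K = j) \<and> dense_at T d k c r S"
    using sys unfolding good_system_def by blast
  \<comment> \<open>The maximum gives nonnegativity without an argument that \<open>W\<close> is
    nonempty.\<close>
  define R where "R = max R0 0"
  \<comment> \<open>A common lower bound for the radii, since \<open>2 * r * 2 ^ K\<close> is a
    positive integer. It lets one \<delta> = e\<rho> satisfy r + \<delta> \<le> r(1 + e) for all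
    patterns.\<close>
  define \<rho> :: real where "\<rho> = 1 / 2 ^ Suc K"
  have \<rho>: "\<rho> > 0" by (simp add: \<rho>_def)
  have dense: "\<exists>r::real. \<rho> \<le> r \<and> r \<le> R \<and> dense_at T d k c r S" if S: "S \<in> W" for S
  proof -
    obtain r :: real and j :: nat where r: "0 < r" "r \<le> R0" "2 * r * 2 ^ K = real j" "dense_at T d k c r S"
      using dense0[OF S] by blast
    have "j \<noteq> 0"
      using r by (metis mult_eq_0_iff of_nat_0 less_irrefl zero_neq_numeral power_not_zero)
    then have "1 \<le> 2 * r * 2 ^ K" unfolding r(3) by simp
    then have "\<rho> \<le> r" unfolding \<rho>_def by (simp add: pos_divide_le_eq mult_ac)
    with r show ?thesis by (auto simp: R_def)
  qed
  obtain e :: real where e: "e > 0" "(1 + e) ^ d \<le> 2" using exists_power_le_two by blast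
  define \<delta> where "\<delta> = e * \<rho>"
  have \<delta>: "\<delta> > 0" using e \<rho> by (simp add: \<delta>_def)
  \<comment> \<open>Makes N + 2R + 1 at most N(1 + e), so boundary effects in all \<open>d\<close>
    directions cost at most a factor 2.\<close>
  obtain N :: nat where N: "real N > (2 * R + 1) / e" using reals_Archimedean2 by blast
  have R: "R \<ge> 0" by (simp add: R_def)
  have N0: "real N > 0" using N e R by (meson add_nonneg_pos divide_pos_pos less_trans mult_nonneg_nonneg zero_le_numeral zero_less_one)
  \<comment> \<open>All lattice points within \<open>R\<close> of the interval from 0 to
    \<open>N\<close>, put in centred form so that \<open>lattice_count_le\<close> applies.\<close>
  define J where "J i = {n::int. \<bar>c i + n / 2 ^ k i - real N / 2\<bar> \<le> real N / 2 + R}" for i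
  define f where "f = comb_prod d k c \<delta> J"
  define G where "G = {x \<in> PiE {..<d} (\<lambda>_. {0..<real N}). pattern k d x \<in> W}"
  let ?L = "{x \<in> space (lebd d). maxfun d f x \<ge> ennreal (T / 2)}"
  have int: "integrable (lebd d) f" unfolding f_def by (rule comb_prod_integrable[OF \<delta>])
  have "G \<subseteq> ?L"
  proof
    fix x assume "x \<in> G"
    then have x: "\<And>i. i < d \<Longrightarrow> 0 \<le> x i \<and> x i < real N" "pattern k d x \<in> W" "x \<in> space (lebd d)"
      by (auto simp: G_def space_lebd PiE_iff)
    obtain r where r: "\<rho> \<le> r" "r \<le> R" "dense_at T d k c r (pattern k d x)"
      using dense[OF x(2)] by blast
    have r0: "r > 0" using r \<rho> by simp
    have JJ: "{n::int. \<bar>c i + n / 2 ^ k i - x i\<bar> \<le> r} \<subseteq> J i" if "i < d" for i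
    proof
      fix n :: int assume "n \<in> {n::int. \<bar>c i + n / 2 ^ k i - x i\<bar> \<le> r}"
      moreover define z where "z = c i + n / 2 ^ k i"
      ultimately have "\<bar>z - x i\<bar> \<le> r" by simp
      then have "\<bar>z - real N / 2\<bar> \<le> real N / 2 + R" using x(1)[OF that] r(2) by linarith
      then show "n \<in> J i" by (simp add: J_def z_def)
    qed
    have "(r + \<delta>) ^ d \<le> (r * (1 + e)) ^ d"
      using r0 \<delta> r e by (intro power_mono) (auto simp: \<delta>_def algebra_simps)
    also have "\<dots> \<le> r ^ d * 2" using e r0 by (simp add: power_mult_distrib)
    finally have "2 ^ d * (r + \<delta>) ^ d \<le> 2 ^ d * (r ^ d * 2)" by (rule mult_left_mono) simp
    then have "(2 * (r + \<delta>)) ^ d \<le> 2 * (2 * r) ^ d" unfolding power_mult_distrib by linarith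
    then have "T / 2 * (2 * (r + \<delta>)) ^ d \<le> T * (2 * r) ^ d" using \<open>T > 0\<close> by simp
    also have "\<dots> \<le> (\<Prod>i<d. lattice_count (k i) (c i) (x i) r / 2 ^ k i)"
      using r(3) by (simp add: dense_at_def)
    finally have "ennreal (T / 2 * (2 * (r + \<delta>)) ^ d)
        \<le> ennreal (\<Prod>i<d. lattice_count (k i) (c i) (x i) r / 2 ^ k i)" by (rule ennreal_leI)
    also have "\<dots> \<le> cube_mass d f (r + \<delta>) x"
      unfolding f_def
      by (rule comb_prod_cube_mass_ge[OF \<delta>]) (use JJ in \<open>auto simp: J_def finite_lattice_points\<close>)
    finally have "ennreal (T / 2 * (2 * (r + \<delta>)) ^ d) / ennreal ((2 * (r + \<delta>)) ^ d)
        \<le> cube_mass d f (r + \<delta>) x / ennreal ((2 * (r + \<delta>)) ^ d)"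
      by (rule divide_right_mono_ennreal)
    also have "ennreal (T / 2 * (2 * (r + \<delta>)) ^ d) / ennreal ((2 * (r + \<delta>)) ^ d) = ennreal (T / 2)"
      using \<open>T > 0\<close> r0 \<delta> by (subst divide_ennreal) auto
    also have "cube_mass d f (r + \<delta>) x / ennreal ((2 * (r + \<delta>)) ^ d) \<le> maxfun d f x"
      unfolding maxfun_eq_SUP using r0 \<delta> by (intro SUP_upper) auto
    finally show "x \<in> ?L" using x by simp
  qed
  moreover have "?L \<in> sets (lebd d)"
    using maxfun_measurable[OF borel_measurable_integrable[OF int]] by measurable
  ultimately have "emeasure (lebd d) G \<le> emeasure (lebd d) ?L" by (rule emeasure_mono)
  moreover have "ennreal (T / 2) * emeasure (lebd d) ?L
      \<le> ennreal C * ennreal (\<integral>x. \<bar>f x\<bar> \<partial>lebd d)"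
    using weak int \<open>T > 0\<close> unfolding weak11_def by simp
  ultimately have "ennreal (T / 2) * emeasure (lebd d) G
      \<le> ennreal C * ennreal (\<integral>x. \<bar>f x\<bar> \<partial>lebd d)"
    by (meson mult_left_mono order_trans zero_le)
  also have "emeasure (lebd d) G = ennreal (card W * (real N / 2) ^ d)"
    unfolding G_def by (rule emeasure_pattern_set[OF W(1)])
  also have "(\<integral>x. \<bar>f x\<bar> \<partial>lebd d) = (\<Prod>i<d. card (J i) / 2 ^ k i)"
    unfolding f_def by (rule comb_prod_integral[OF \<delta>])
  finally have main: "T / 2 * (card W * (real N / 2) ^ d) \<le> C * (\<Prod>i<d. card (J i) / 2 ^ k i)"
    using \<open>T > 0\<close> \<open>C > 0\<close> N0
    by (simp add: ennreal_mult[symmetric] prod_nonneg ennreal_le_iff)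
  have "card W + card (Pow {..<d} - W) = card (Pow {..<d})"
    using W(1) finite_subset[OF W(1)] card_mono[OF _ W(1)] by (simp add: card_Diff_subset)
  then have "real (card W) + real (card (Pow {..<d} - W)) = 2 ^ d"
    by (metis of_nat_add card_Pow finite_lessThan card_lessThan of_nat_power of_nat_numeral)
  then have cW: "2 ^ d / 2 \<le> real (card W)" using W(2) by linarith
  have "T / 4 * real N ^ d = T / 2 * (2 ^ d / 2 * (real N / 2) ^ d)" by (simp add: power_divide)
  also have "\<dots> \<le> T / 2 * (card W * (real N / 2) ^ d)"
    using cW \<open>T > 0\<close> by (intro mult_left_mono mult_right_mono) auto
  also note main
  also have "C * (\<Prod>i<d. card (J i) / 2 ^ k i) \<le> C * (\<Prod>i<d. real N * (1 + e))"
  proof (intro mult_left_mono prod_mono conjI)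
    fix i
    have "card (J i) / 2 ^ k i \<le> 2 * (real N / 2 + R) + 1"
      unfolding J_def lattice_count_def[symmetric] using R by (intro lattice_count_le) simp
    also have "\<dots> \<le> real N * (1 + e)" using N e by (simp add: field_simps)
    finally show "card (J i) / 2 ^ k i \<le> real N * (1 + e)" .
  qed (use \<open>C > 0\<close> in auto)
  also have "\<dots> = C * real N ^ d * (1 + e) ^ d" by (simp add: power_mult_distrib)
  also have "\<dots> \<le> C * real N ^ d * 2" using e \<open>C > 0\<close> by (intro mult_left_mono) auto
  finally show ?thesis using N0 by simp
qed

theorem mainTheorem1:
  shows "(\<forall>T>0. \<exists>D. \<forall>d\<ge>D. best_const d \<ge> ereal T) \<and> (best_const \<longlonglongrightarrow> \<infinity>)"
proof -
  have ge: "\<exists>D. \<forall>d\<ge>D. best_const d \<ge> ereal T" if "T > 0" for T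
  proof -
    obtain D where D: "\<And>d. d \<ge> D \<Longrightarrow> \<exists>K. good_system (8 * T) (1/2) d K"
      using good_system_exists[of "8 * T"] \<open>T > 0\<close> by auto
    have "best_const d \<ge> ereal T" if "d \<ge> D" for d
      unfolding best_const_def
    \<comment> \<open>This also covers the case without admissible constants, where the infimum is
      +infinity.\<close>
    proof (rule Inf_greatest)
      fix z assume "z \<in> {ereal c |c. c > 0 \<and> weak11 d c}"
      then obtain C where C: "z = ereal C" "C > 0" "weak11 d C" by blast
      obtain K where "good_system (8 * T) (1/2) d K" using D[OF \<open>d \<ge> D\<close>] by blast
      from weak11_const_ge[OF this _ C(3,2)] \<open>T > 0\<close> C show "ereal T \<le> z" by simp
    qed
    then show ?thesis by blast
  qed
  moreover have "best_const \<longlonglongrightarrow> \<infinity>"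
    unfolding tendsto_PInfty
  proof
    fix r :: real
    \<comment> \<open>A positive level strictly above \<open>r\<close>: the bound needs T > 0, and
      the limit asks for a strict inequality.\<close>
    have "\<bar>r\<bar> + 1 > 0" by linarith
    from ge[OF this] obtain D where D: "\<forall>d\<ge>D. best_const d \<ge> ereal (\<bar>r\<bar> + 1)" ..
    have "ereal r < best_const d" if "d \<ge> D" for d
    proof -
      have "ereal r < ereal (\<bar>r\<bar> + 1)" by simp
      also have "\<dots> \<le> best_const d" using D that by blast
      finally show ?thesis .
    qed
    then show "eventually (\<lambda>d. ereal r < best_const d) sequentially"
      unfolding eventually_sequentially by blast
  qed
  ultimately show ?thesis by blast
qed

end
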